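(* Let $n \ge 1$, $\alpha\in(0,1)$, and let $\xi_1,\dots,\xi_n$ be independent random variables with $\Pr(\xi_i=k) = (1-\alpha)\alpha^k$ for $k\in\mathbb{Z}_+$. The random set $G_n = U(\xi_1,\dots,\xi_n)$ is distributed according to the Gibbs measure $$\mu_\beta(B) = Z_{n,\beta}^{-1}\, e^{-\beta H(B)}, \quad B \in S_n,$$ where $\beta = -\log\alpha$, $H(B) = \sum_{x\in B} x$, and the normalizing constant is $$Z_{n,\beta} = \prod_{k=1}^n \frac{e^\beta}{e^{\beta k}-1}.$$
   Context: $\mathbb{Z}_+ = \{0,1,2,\dots\}$; $S_n$ is the set of $n$-element subsets of $\mathbb{Z}_+$; $[0,m]=\{0,1,\dots,m\}$. For finite $A\subset\mathbb{Z}_+$, the $A$-avoiding shift is $\theta_A(x) = \min\{m \ge 0 : |[0,m]\setminus A| \ge x+1\}$, $x\in\mathbb{Z}_+$. The noncolliding union of $A$ and (possibly nondistinct) points $x_1,\dots,x_n\in\mathbb{Z}_+$ is defined recursively by $U(A,x_1) = A\cup\{\theta_A(x_1)\}$ and $U(A,x_1,\dots,x_{k+1}) = C\cup\{\theta_{C}(x_{k+1})\}$ with $C = U(A,x_1,\dots,x_k)$; and $U(x_1,\dots,x_n) = U(\emptyset,x_1,\dots,x_n)$. *)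

theory Defs
  imports "HOL-Probability.Probability"
begin

definition n_subsets :: "nat \<Rightarrow> nat set set" where
  "n_subsets n = {B. finite B \<and> card B = n}"

(* The A-avoiding shift; the minimum exists whenever A is finite. *)
definition avoiding_shift :: "nat set \<Rightarrow> nat \<Rightarrow> nat" where
  "avoiding_shift A x = (LEAST m. card ({0..m} - A) \<ge> x + 1)"

(* noncolliding_union A x n is U(A, x 1, ..., x n): the points are the values
   of the sequence x at the indices 1, ..., n, and U of no points is A. *)
primrec noncolliding_union :: "nat set \<Rightarrow> (nat \<Rightarrow> nat) \<Rightarrow> nat \<Rightarrow> nat set" where
  "noncolliding_union A x 0 = A"
| "noncolliding_union A x (Suc k) =
     (let C = noncolliding_union A x k in C \<union> {avoiding_shift C (x (Suc k))})"

definition hamiltonian :: "nat set \<Rightarrow> real" where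
  "hamiltonian B = (\<Sum>x\<in>B. real x)"

definition partition_function :: "nat \<Rightarrow> real \<Rightarrow> real" where
  "partition_function n \<beta> = (\<Sum>\<^sub>\<infinity>B\<in>n_subsets n. exp (- \<beta> * hamiltonian B))"

definition gibbs_measure :: "nat \<Rightarrow> real \<Rightarrow> nat set measure" where
  "gibbs_measure n \<beta> = point_measure (n_subsets n)
     (\<lambda>B. ennreal (inverse (partition_function n \<beta>) * exp (- \<beta> * hamiltonian B)))"

end

theory Submission
  imports Defs
begin

text \<open>
  For finite \<open>C\<close> and \<open>b \<notin> C\<close>, the point \<open>x\<close> is shifted to \<open>b\<close> exactly when \<open>x\<close> is the number of
  free sites below \<open>b\<close>. Hence a geometric point falls on \<open>b\<close> with probability
  \<open>(1 - \<alpha>) \<alpha> ^ (b - r)\<close>, where \<open>r\<close> counts the elements of \<open>C\<close> below \<open>b\<close>.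

  Suppose that the set built from \<open>k\<close> points equals \<open>C\<close> with probability \<open>w \<alpha> ^ (\<Sum>C)\<close>. A set \<open>B\<close>
  with \<open>k + 1\<close> elements arises from \<open>C = B - {b}\<close> for one of its elements \<open>b\<close>, the one added last;
  by independence, and with \<open>r\<close> the number of elements of \<open>B\<close> below \<open>b\<close>, that element contributes
  \<open>w \<alpha> ^ (\<Sum>B - b) (1 - \<alpha>) \<alpha> ^ (b - r) = w (1 - \<alpha>) \<alpha> ^ (\<Sum>B) (1/\<alpha>) ^ r\<close>.
  The dependence on \<open>b\<close> is through its rank alone, and the ranks of the elements of \<open>B\<close> are
  \<open>0, \<dots>, k\<close>. So the sum over \<open>b\<close> is a geometric sum that depends only on \<open>k\<close>, and the weight
  \<open>\<alpha> ^ (\<Sum>B)\<close> reproduces itself with the new constant \<open>w \<alpha> ((1/\<alpha>) ^ (k + 1) - 1)\<close>.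

  This gives the law of the union explicitly (lemma \<open>prob_noncolliding_union\<close>). Since there
  are only countably many finite sets of naturals, these probabilities sum to one. This shows at
  once that the Gibbs weights are summable and that the partition function is the inverse of the
  accumulated constant.
\<close>

section \<open>The avoiding shift and the last point of a union\<close>

text \<open>
  The number of free sites in \<open>{0..m}\<close> grows by one at a free \<open>m\<close> and is unchanged at an occupied
  one, so the minimum in the definition is attained at a free site with exactly \<open>x\<close> free sites
  below it; there is only one such site.
\<close>
lemma avoiding_shift_eq_iff:
  assumes "finite C"
  shows "avoiding_shift C x = b \<longleftrightarrow> b \<notin> C \<and> card ({..<b} - C) = x"
proof -
  have step: "card ({0..m} - C) = card ({..<m} - C) + (if m \<in> C then 0 else 1)" for m
  proof (cases "m \<in> C")
    case True
    then have "{0..m} - C = {..<m} - C" by (auto simp: le_less)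
    with True show ?thesis by simp
  next
    case False
    then have "{0..m} - C = insert m ({..<m} - C)" by auto
    with False show ?thesis by simp
  qed
  have mono: "card ({0..m} - C) \<le> card ({..<b} - C)" if "m < b" for m b
    using that by (intro card_mono) auto
  have attained: "avoiding_shift C x = b" if "b \<notin> C" "card ({..<b} - C) = x" for b
    unfolding avoiding_shift_def
  proof (rule Least_equality)
    show "x + 1 \<le> card ({0..b} - C)" using step[of b] that by simp
    show "b \<le> m" if "x + 1 \<le> card ({0..m} - C)" for m
      using mono[of m b] that \<open>card ({..<b} - C) = x\<close> by (cases "b \<le> m") auto
  qed
  define s where "s = avoiding_shift C x"
  have "card {0..x + card C} - card C \<le> card ({0..x + card C} - C)"
    by (rule diff_card_le_card_Diff[OF assms])
  then have "x + 1 \<le> card ({0..x + card C} - C)" by simp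
  then have s: "x + 1 \<le> card ({0..s} - C)"
    unfolding s_def avoiding_shift_def by (rule LeastI)
  have least: "\<not> x + 1 \<le> card ({0..m} - C)" if "m < s" for m
    using that unfolding s_def avoiding_shift_def by (rule not_less_Least)
  have below: "card ({..<s} - C) \<le> x"
  proof (cases s)
    case (Suc m)
    then have "{..<s} = {0..m}" by auto
    then show ?thesis using least[of m] Suc by simp
  qed simp
  have "s \<notin> C \<and> card ({..<s} - C) = x"
    using s step[of s] below by (auto split: if_splits)
  then show ?thesis
    using attained[of b] by (auto simp flip: s_def)
qed

lemma avoiding_shift_notin: "finite C \<Longrightarrow> avoiding_shift C x \<notin> C"
  using avoiding_shift_eq_iff[of C x "avoiding_shift C x"] by simp

lemma noncolliding_union_in_n_subsets:
  "noncolliding_union {} x k \<in> n_subsets k"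
proof (induction k)
  case (Suc k)
  then have "finite (noncolliding_union {} x k)" by (simp add: n_subsets_def)
  with Suc show ?case
    by (simp add: n_subsets_def Let_def avoiding_shift_notin)
qed (simp add: n_subsets_def)

lemma noncolliding_union_cong:
  "(\<And>i. i \<in> {1..k} \<Longrightarrow> x i = y i) \<Longrightarrow> noncolliding_union A x k = noncolliding_union A y k"
  by (induction k) (simp_all add: Let_def)

text \<open>
  The backward form of the recursion. It turns the event that the union equals \<open>B\<close> into a finite
  disjoint union, indexed by the element \<open>b\<close> added last, of events on the earlier points and on
  the new point separately.
\<close>
lemma noncolliding_union_Suc_eq_iff:
  "noncolliding_union {} x (Suc k) = B \<longleftrightarrow>
     (\<exists>b\<in>B. noncolliding_union {} x k = B - {b} \<and> x (Suc k) = card ({..<b} - B))"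
proof -
  define C where "C = noncolliding_union {} x k"
  have C: "finite C"
    using noncolliding_union_in_n_subsets[of x k] by (simp add: C_def n_subsets_def)
  have remove: "{..<b} - (B - {b}) = {..<b} - B" for b by auto
  have "C \<union> {avoiding_shift C (x (Suc k))} = B \<longleftrightarrow>
      (\<exists>b\<in>B. C = B - {b} \<and> avoiding_shift C (x (Suc k)) = b)"
    using avoiding_shift_notin[OF C, of "x (Suc k)"] by auto
  also have "\<dots> \<longleftrightarrow> (\<exists>b\<in>B. C = B - {b} \<and> x (Suc k) = card ({..<b} - B))"
    using avoiding_shift_eq_iff[OF C, of "x (Suc k)"] remove by (metis DiffD2 singletonI)
  finally show ?thesis by (simp add: C_def Let_def)
qed

text \<open>
  The elements of \<open>B\<close>, in increasing order, have \<open>0, 1, \<dots>, card B - 1\<close> elements of \<open>B\<close> below them.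
\<close>
lemma sum_over_ranks:
  fixes B :: "nat set"
  assumes "finite B"
  shows "(\<Sum>b\<in>B. f (card (B \<inter> {..<b}))) = (\<Sum>r<card B. f r)"
  using assms
proof (induction B rule: finite_linorder_max_induct)
  case (insert m B)
  have "m \<notin> B" using insert by auto
  have "(\<Sum>b\<in>insert m B. f (card (insert m B \<inter> {..<b})))
      = f (card (insert m B \<inter> {..<m})) + (\<Sum>b\<in>B. f (card (insert m B \<inter> {..<b})))"
    using insert \<open>m \<notin> B\<close> by simp
  also have "insert m B \<inter> {..<m} = B" using insert by auto
  also have "(\<Sum>b\<in>B. f (card (insert m B \<inter> {..<b}))) = (\<Sum>b\<in>B. f (card (B \<inter> {..<b})))"
  proof (rule sum.cong)
    fix b assume "b \<in> B"
    then have "insert m B \<inter> {..<b} = B \<inter> {..<b}" using insert by auto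
    then show "f (card (insert m B \<inter> {..<b})) = f (card (B \<inter> {..<b}))" by simp
  qed simp
  finally show ?case using insert \<open>m \<notin> B\<close> by (simp add: add.commute)
qed simp

text \<open>
  One step of the recursion for the law: the summand for \<open>b\<close> is the weight of \<open>B - {b}\<close> times the
  probability that a geometric point falls on \<open>b\<close>.
\<close>
lemma sum_last_point_weights:
  fixes \<alpha> :: real
  assumes "\<alpha> \<noteq> 0" "\<alpha> \<noteq> 1" "finite B"
  shows "(\<Sum>b\<in>B. \<alpha> ^ \<Sum>(B - {b}) * ((1 - \<alpha>) * \<alpha> ^ card ({..<b} - B)))
    = \<alpha> * ((1 / \<alpha>) ^ card B - 1) * \<alpha> ^ \<Sum>B"
proof -
  have "\<alpha> ^ \<Sum>(B - {b}) * ((1 - \<alpha>) * \<alpha> ^ card ({..<b} - B))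
      = (1 - \<alpha>) * \<alpha> ^ \<Sum>B * (1 / \<alpha>) ^ card (B \<inter> {..<b})" if "b \<in> B" for b
  proof -
    have "card ({..<b} - B) + card (B \<inter> {..<b}) = card {..<b}"
      using card_Diff_subset_Int[of "{..<b}" B] card_mono[of "{..<b}" "B \<inter> {..<b}"]
      by (simp add: Int_commute)
    then have "\<Sum>B = \<Sum>(B - {b}) + (card ({..<b} - B) + card (B \<inter> {..<b}))"
      using sum.remove[OF assms(3) that, of "\<lambda>x. x"] by simp
    then show ?thesis
      using assms(1) by (simp only: power_add) (simp add: power_one_over field_simps)
  qed
  then have "(\<Sum>b\<in>B. \<alpha> ^ \<Sum>(B - {b}) * ((1 - \<alpha>) * \<alpha> ^ card ({..<b} - B)))
      = (1 - \<alpha>) * \<alpha> ^ \<Sum>B * (\<Sum>b\<in>B. (1 / \<alpha>) ^ card (B \<inter> {..<b}))"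
    unfolding sum_distrib_left by (rule sum.cong[OF refl])
  also have "(\<Sum>b\<in>B. (1 / \<alpha>) ^ card (B \<inter> {..<b})) = (\<Sum>r<card B. (1 / \<alpha>) ^ r)"
    by (rule sum_over_ranks[OF assms(3)])
  also have "\<dots> = ((1 / \<alpha>) ^ card B - 1) / (1 / \<alpha> - 1)"
    using assms by (intro geometric_sum) auto
  also have "1 / \<alpha> - 1 = (1 - \<alpha>) / \<alpha>" using assms(1) by (simp add: field_simps)
  finally show ?thesis using assms by simp
qed

section \<open>The law of the noncolliding union\<close>

lemma measurable_noncolliding_union_PiM:
  "(\<lambda>x. noncolliding_union A x k)
     \<in> measurable (PiM {1..k} (\<lambda>_. count_space UNIV)) (count_space UNIV)"
  by (subst count_space_PiM_finite) auto

lemma noncolliding_union_restrict: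
  "noncolliding_union A (restrict x {1..k}) k = noncolliding_union A x k"
  by (rule noncolliding_union_cong) simp

lemma measurable_noncolliding_union:
  assumes "\<And>i. i \<in> {1..k} \<Longrightarrow> \<xi> i \<in> measurable M (count_space UNIV)"
  shows "(\<lambda>\<omega>. noncolliding_union A (\<lambda>i. \<xi> i \<omega>) k) \<in> measurable M (count_space UNIV)"
proof -
  have "(\<lambda>\<omega>. restrict (\<lambda>i. \<xi> i \<omega>) {1..k}) \<in> measurable M (PiM {1..k} (\<lambda>_. count_space UNIV))"
    using assms by (intro measurable_restrict)
  from measurable_compose[OF this measurable_noncolliding_union_PiM]
  show ?thesis by (simp only: noncolliding_union_restrict)
qed

text \<open>
  The union of the first \<open>k\<close> points depends on the coordinates \<open>1, \<dots>, k\<close> only, and a finite product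
  of countable discrete spaces is discrete, so any condition on it is an event of these coordinates.
\<close>
lemma (in prob_space) prob_noncolliding_union_next_point:
  fixes \<xi> :: "nat \<Rightarrow> 'a \<Rightarrow> nat"
  assumes "indep_vars (\<lambda>_. count_space UNIV) \<xi> {1..n}" "Suc k \<le> n"
  shows "prob {\<omega> \<in> space M. noncolliding_union A (\<lambda>i. \<xi> i \<omega>) k = C \<and> \<xi> (Suc k) \<omega> = m}
    = prob {\<omega> \<in> space M. noncolliding_union A (\<lambda>i. \<xi> i \<omega>) k = C}
      * prob {\<omega> \<in> space M. \<xi> (Suc k) \<omega> = m}"
proof -
  let ?P = "\<lambda>I. PiM I (\<lambda>_. count_space (UNIV :: nat set))"
  let ?X = "\<lambda>I \<omega>. restrict (\<lambda>i. \<xi> i \<omega>) I"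
  define S where "S = {x \<in> space (?P {1..k}). noncolliding_union A x k = C}"
  define T where "T = {x \<in> space (?P {Suc k}). x (Suc k) = m}"
  have "indep_var (?P {1..k}) (?X {1..k}) (?P {Suc k}) (?X {Suc k})"
    using assms by (intro indep_var_restrict) auto
  moreover have "S \<in> sets (?P {1..k})" "T \<in> sets (?P {Suc k})"
    by (simp_all add: S_def T_def count_space_PiM_finite)
  ultimately have "prob ((\<lambda>\<omega>. (?X {1..k} \<omega>, ?X {Suc k} \<omega>)) -` (S \<times> T) \<inter> space M)
      = prob (?X {1..k} -` S \<inter> space M) * prob (?X {Suc k} -` T \<inter> space M)"
    by (rule indep_varD)
  also have "?X {1..k} -` S \<inter> space M
      = {\<omega> \<in> space M. noncolliding_union A (\<lambda>i. \<xi> i \<omega>) k = C}"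
    by (auto simp: S_def space_PiM noncolliding_union_restrict simp del: One_nat_def)
  also have "?X {Suc k} -` T \<inter> space M = {\<omega> \<in> space M. \<xi> (Suc k) \<omega> = m}"
    by (auto simp: T_def space_PiM)
  also have "(\<lambda>\<omega>. (?X {1..k} \<omega>, ?X {Suc k} \<omega>)) -` (S \<times> T) \<inter> space M
      = {\<omega> \<in> space M. noncolliding_union A (\<lambda>i. \<xi> i \<omega>) k = C \<and> \<xi> (Suc k) \<omega> = m}"
    by (auto simp: S_def T_def space_PiM noncolliding_union_restrict simp del: One_nat_def)
  finally show ?thesis .
qed

text \<open>
  Induction on the number of points, conditioning on which element of \<open>B\<close> is added last. The factor
  \<open>\<alpha> * ((1 / \<alpha>) ^ j - 1)\<close> is \<open>1 - \<alpha>\<close> times the geometric sum over the \<open>j\<close> possible ranks of the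
  \<open>j\<close>-th point.
\<close>
lemma (in prob_space) prob_noncolliding_union:
  fixes \<xi> :: "nat \<Rightarrow> 'a \<Rightarrow> nat" and \<alpha> :: real
  assumes "0 < \<alpha>" "\<alpha> < 1"
    and indep: "indep_vars (\<lambda>_. count_space UNIV) \<xi> {1..n}"
    and geometric: "\<And>i k. i \<in> {1..n} \<Longrightarrow> prob {\<omega> \<in> space M. \<xi> i \<omega> = k} = (1 - \<alpha>) * \<alpha> ^ k"
    and "k \<le> n" "B \<in> n_subsets k"
  shows "prob {\<omega> \<in> space M. noncolliding_union {} (\<lambda>i. \<xi> i \<omega>) k = B}
    = (\<Prod>j=1..k. \<alpha> * ((1 / \<alpha>) ^ j - 1)) * \<alpha> ^ \<Sum>B"
  using assms(5,6)
proof (induction k arbitrary: B)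
  case 0
  then have "B = {}" by (auto simp: n_subsets_def)
  then show ?case using prob_space by simp
next
  case (Suc k)
  define U where "U = (\<lambda>\<omega>. noncolliding_union {} (\<lambda>i. \<xi> i \<omega>) k)"
  define w where "w = (\<Prod>j=1..k. \<alpha> * ((1 / \<alpha>) ^ j - 1))"
  define E where "E = (\<lambda>b. {\<omega> \<in> space M. U \<omega> = B - {b} \<and> \<xi> (Suc k) \<omega> = card ({..<b} - B)})"
  have B: "finite B" "card B = Suc k" using Suc.prems by (auto simp: n_subsets_def)
  have \<xi>_meas: "\<xi> i \<in> measurable M (count_space UNIV)" if "i \<in> {1..n}" for i
    using indep that unfolding indep_vars_def by blast
  have [measurable]: "U \<in> measurable M (count_space UNIV)"
    unfolding U_def using Suc.prems by (intro measurable_noncolliding_union \<xi>_meas) auto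
  have [measurable]: "\<xi> (Suc k) \<in> measurable M (count_space UNIV)"
    using Suc.prems by (intro \<xi>_meas) auto
  have E_meas: "E b \<in> events" for b unfolding E_def by measurable
  have prob_E: "prob (E b) = w * (\<alpha> ^ \<Sum>(B - {b}) * ((1 - \<alpha>) * \<alpha> ^ card ({..<b} - B)))"
    if "b \<in> B" for b
  proof -
    have "prob (E b) = prob {\<omega> \<in> space M. U \<omega> = B - {b}}
        * prob {\<omega> \<in> space M. \<xi> (Suc k) \<omega> = card ({..<b} - B)}"
      unfolding E_def U_def using indep Suc.prems(1)
      by (rule prob_noncolliding_union_next_point)
    also have "prob {\<omega> \<in> space M. U \<omega> = B - {b}} = w * \<alpha> ^ \<Sum>(B - {b})"
      unfolding U_def w_def using Suc.prems that B by (intro Suc.IH) (auto simp: n_subsets_def)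
    also have "prob {\<omega> \<in> space M. \<xi> (Suc k) \<omega> = card ({..<b} - B)}
        = (1 - \<alpha>) * \<alpha> ^ card ({..<b} - B)"
      using Suc.prems by (intro geometric) auto
    finally show ?thesis by simp
  qed
  have "{\<omega> \<in> space M. noncolliding_union {} (\<lambda>i. \<xi> i \<omega>) (Suc k) = B} = (\<Union>b\<in>B. E b)"
    unfolding noncolliding_union_Suc_eq_iff E_def U_def by auto
  moreover have "disjoint_family_on E B"
    unfolding disjoint_family_on_def E_def by auto
  ultimately have "prob {\<omega> \<in> space M. noncolliding_union {} (\<lambda>i. \<xi> i \<omega>) (Suc k) = B}
      = (\<Sum>b\<in>B. prob (E b))"
    using B E_meas by (simp add: finite_measure_finite_Union image_subset_iff)
  also have "\<dots> = w * (\<Sum>b\<in>B. \<alpha> ^ \<Sum>(B - {b}) * ((1 - \<alpha>) * \<alpha> ^ card ({..<b} - B)))"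
    by (simp add: prob_E sum_distrib_left)
  also have "\<dots> = w * (\<alpha> * ((1 / \<alpha>) ^ card B - 1) * \<alpha> ^ \<Sum>B)"
    using assms(1,2) B by (subst sum_last_point_weights) auto
  finally show ?case using B by (simp add: w_def)
qed

section \<open>Normalization\<close>

lemma (in prob_space) has_sum_prob_singletons:
  assumes "sets M = Pow A" "countable A"
  shows "((\<lambda>x. prob {x}) has_sum 1) A"
proof -
  have "space M = A" using sets_eq_imp_space_eq[of M "count_space A"] assms(1) by simp
  then have "(\<integral>\<^sup>+x. emeasure M {x} \<partial>count_space A) = 1"
    using assms emeasure_space_1 emeasure_countable_singleton[of A M] by simp
  then have "(\<integral>\<^sup>+x. ennreal (prob {x}) \<partial>count_space A) = ennreal 1"
    by (simp add: emeasure_eq_measure)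
  then have "integrable (count_space A) (\<lambda>x. prob {x})"
      "(\<integral>x. prob {x} \<partial>count_space A) = 1"
    by (subst (asm) nn_integral_eq_integrable; simp)+
  then have "Infinite_Set_Sum.abs_summable_on (\<lambda>x. prob {x}) A" "infsetsum (\<lambda>x. prob {x}) A = 1"
    by (simp_all add: Infinite_Set_Sum.abs_summable_on_def infsetsum_def)
  then show ?thesis
    by (metis abs_summable_equivalent abs_summable_summable has_sum_infsum infsetsum_infsum)
qed

lemma countable_n_subsets: "countable (n_subsets n)"
  by (rule countable_subset[OF _ countable_Collect_finite]) (auto simp: n_subsets_def)

theorem theorem3p8:
  fixes M :: "'a measure" and \<xi> :: "nat \<Rightarrow> 'a \<Rightarrow> nat"
    and n :: nat and \<alpha> \<beta> :: real and G :: "'a \<Rightarrow> nat set"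
  assumes "prob_space M"
    and "n \<ge> 1"
    and "0 < \<alpha>" and "\<alpha> < 1"
    and "prob_space.indep_vars M (\<lambda>_. count_space UNIV) \<xi> {1..n}"
    and "\<And>i k. i \<in> {1..n} \<Longrightarrow> measure M {\<omega> \<in> space M. \<xi> i \<omega> = k} = (1 - \<alpha>) * \<alpha> ^ k"
  defines "G \<equiv> (\<lambda>\<omega>. noncolliding_union {} (\<lambda>i. \<xi> i \<omega>) n)"
    and "\<beta> \<equiv> - ln \<alpha>"
  shows "G \<in> measurable M (count_space (n_subsets n))
       \<and> distr M (count_space (n_subsets n)) G = gibbs_measure n \<beta>
       \<and> (\<lambda>B. exp (- \<beta> * hamiltonian B)) summable_on n_subsets n
       \<and> partition_function n \<beta> = (\<Prod>k=1..n. exp \<beta> / (exp (\<beta> * real k) - 1))"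
proof -
  interpret prob_space M by fact
  define D where "D = distr M (count_space (n_subsets n)) G"
  define w where "w = (\<Prod>j=1..n. \<alpha> * ((1 / \<alpha>) ^ j - 1))"
  have "\<xi> i \<in> measurable M (count_space UNIV)" if "i \<in> {1..n}" for i
    using assms(5) that unfolding indep_vars_def by blast
  then have "G \<in> measurable M (count_space UNIV)"
    unfolding G_def by (rule measurable_noncolliding_union)
  moreover have "G \<omega> \<in> n_subsets n" for \<omega>
    unfolding G_def by (rule noncolliding_union_in_n_subsets)
  ultimately have G: "G \<in> measurable M (count_space (n_subsets n))"
    by (auto simp: measurable_def)
  interpret D: prob_space D unfolding D_def using G by (rule prob_space_distr)

  have exp_beta: "exp \<beta> = 1 / \<alpha>"
    using assms(3) by (simp add: \<beta>_def exp_minus inverse_eq_divide)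
  have weight: "exp (- \<beta> * hamiltonian B) = \<alpha> ^ \<Sum>B" for B
  proof -
    have "- \<beta> * hamiltonian B = real (\<Sum>B) * ln \<alpha>"
      by (simp add: \<beta>_def hamiltonian_def)
    then show ?thesis using assms(3) by (simp only: exp_of_nat_mult) simp
  qed
  have "(1 / \<alpha>) ^ j > 1" if "j \<in> {1..n}" for j
    using assms(3,4) that by (intro one_less_power) auto
  then have "w > 0" unfolding w_def using assms(3) by (intro prod_pos) auto

  have prob_D: "D.prob {B} = w * \<alpha> ^ \<Sum>B" if "B \<in> n_subsets n" for B
  proof -
    have "D.prob {B} = prob (G -` {B} \<inter> space M)"
      unfolding D_def using G that by (intro measure_distr) auto
    also have "G -` {B} \<inter> space M = {\<omega> \<in> space M. G \<omega> = B}" by auto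
    finally show ?thesis
      unfolding G_def w_def using prob_noncolliding_union[OF assms(3-6) order_refl that] by simp
  qed
  have "((\<lambda>B. D.prob {B}) has_sum 1) (n_subsets n)"
    by (rule D.has_sum_prob_singletons) (simp_all add: D_def countable_n_subsets)
  then have "((\<lambda>B. w * \<alpha> ^ \<Sum>B) has_sum 1) (n_subsets n)"
    using prob_D by (simp cong: has_sum_cong)
  then have "((\<lambda>B. inverse w * (w * \<alpha> ^ \<Sum>B)) has_sum (inverse w * 1)) (n_subsets n)"
    by (rule has_sum_cmult_right)
  then have has_sum: "((\<lambda>B. exp (- \<beta> * hamiltonian B)) has_sum inverse w) (n_subsets n)"
    unfolding weight using \<open>w > 0\<close> by (simp add: mult.assoc[symmetric])
  then have Z: "partition_function n \<beta> = inverse w"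
    unfolding partition_function_def by (rule infsumI)

  have "D = gibbs_measure n \<beta>"
  proof (rule measure_eqI_countable[OF _ _ countable_n_subsets])
    fix B assume "B \<in> n_subsets n"
    then show "emeasure D {B} = emeasure (gibbs_measure n \<beta>) {B}"
      unfolding gibbs_measure_def Z weight
      by (simp add: emeasure_point_measure_finite2 D.emeasure_eq_measure prob_D)
  qed (simp_all add: D_def gibbs_measure_def sets_point_measure)
  moreover have "inverse w = (\<Prod>k=1..n. exp \<beta> / (exp (\<beta> * real k) - 1))"
  proof -
    have "exp (\<beta> * real k) = (1 / \<alpha>) ^ k" for k
      using exp_of_nat_mult[of k \<beta>] by (simp add: mult.commute exp_beta)
    then show ?thesis
      unfolding w_def exp_beta prod_inversef[symmetric] by (simp add: field_simps)
  qed
  ultimately show ?thesis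
    using G has_sum Z unfolding D_def summable_on_def by auto
qed

end
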